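(* Let $U_9=\{L(\alpha)\in CE(\mu_7): b=b_{1,4}=0,\ b_{1,2}\neq0,\ b_{1,1}\neq0\}$, and for $\alpha=(b_{0,0},b_{0,1},b_{1,1},b_{1,2},b_{1,4},b)$ put $\Delta=b_{0,1}^2-4b_{0,0}b_{1,1}$ (and $\Delta'=b_{0,1}'^2-4b_{0,0}'b_{1,1}'$ for $\alpha'$). (1) Two algebras $L(\alpha)$ and $L(\alpha')$ from $U_9$ are isomorphic if and only if $$\left(\frac{b_{1,2}}{b_{1,1}}\right)^{10}\Delta=\left(\frac{b_{1,2}'}{b_{1,1}'}\right)^{10}\Delta'.$$ (2) For any $\lambda\in\mathbb{C}$ there exists $L(\alpha)\in U_9$ with $\left(\frac{b_{1,2}}{b_{1,1}}\right)^{10}\Delta=\lambda$. Then the algebras from $U_9$ can be parameterized as $L(\lambda,0,1,1,0,0)$, $\lambda\in\mathbb{C}$; that is, every algebra in $U_9$ is isomorphic to $L(\lambda,0,1,1,0,0)$ for some $\lambda\in\mathbb{C}$.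
   Context: A Leibniz algebra over $\mathbb{C}$ is a complex vector space with a bilinear bracket satisfying $[x,[y,z]]=[[x,y],z]-[[x,z],y]$. $CE(\mu_7)$ (one-dimensional Leibniz central extensions of the 7-dimensional naturally graded filiform Lie algebra $\mu_7$) is the class of the 8-dimensional complex Leibniz algebras $L(\alpha)$, $\alpha=(b_{0,0},b_{0,1},b_{1,1},b_{1,2},b_{1,4},b)$ with $b_{i,j}\in\mathbb{C}$, $b\in\{0,1\}$, with basis $e_0,\dots,e_7$ and brackets $[e_i,e_0]=e_{i+1}$ ($1\le i\le 6$), $[e_0,e_i]=-e_{i+1}$ ($2\le i\le 6$), $[e_0,e_0]=b_{0,0}e_7$, $[e_0,e_1]=-e_2+b_{0,1}e_7$, $[e_1,e_1]=b_{1,1}e_7$, $[e_1,e_2]=-[e_2,e_1]=b_{1,2}e_7$, $[e_1,e_4]=-[e_4,e_1]=b_{1,4}e_7$, $[e_2,e_3]=-[e_3,e_2]=-b_{1,4}e_7$, $[e_1,e_6]=-[e_6,e_1]=-b\,e_7$, $[e_2,e_5]=-[e_5,e_2]=b\,e_7$, $[e_3,e_4]=-[e_4,e_3]=-b\,e_7$, all other brackets of basis vectors being zero. Isomorphic means isomorphic as Leibniz algebras. *)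

theory Defs
  imports "HOL-Analysis.Analysis"
begin

section \<open>Complex Leibniz algebras\<close>

locale leibniz_algebra = vector_space scale
  for scale :: "complex \<Rightarrow> 'v::ab_group_add \<Rightarrow> 'v" +
  fixes bracket :: "'v \<Rightarrow> 'v \<Rightarrow> 'v"
  assumes linear_left: "Vector_Spaces.linear scale scale (\<lambda>x. bracket x y)"
    and linear_right: "Vector_Spaces.linear scale scale (\<lambda>y. bracket x y)"
    and leibniz: "bracket x (bracket y z) = bracket (bracket x y) z - bracket (bracket x z) y"

locale leibniz_algebra_hom =
  dom: leibniz_algebra s1 br1 + cod: leibniz_algebra s2 br2 + Vector_Spaces.linear s1 s2 f
  for s1 :: "complex \<Rightarrow> 'v::ab_group_add \<Rightarrow> 'v" and br1 :: "'v \<Rightarrow> 'v \<Rightarrow> 'v"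
    and s2 :: "complex \<Rightarrow> 'w::ab_group_add \<Rightarrow> 'w" and br2 :: "'w \<Rightarrow> 'w \<Rightarrow> 'w"
    and f :: "'v \<Rightarrow> 'w" +
  assumes bracket: "f (br1 x y) = br2 (f x) (f y)"

definition leibniz_isomorphic ::
  "(complex \<Rightarrow> 'v::ab_group_add \<Rightarrow> 'v) \<Rightarrow> ('v \<Rightarrow> 'v \<Rightarrow> 'v) \<Rightarrow>
   (complex \<Rightarrow> 'w::ab_group_add \<Rightarrow> 'w) \<Rightarrow> ('w \<Rightarrow> 'w \<Rightarrow> 'w) \<Rightarrow> bool" where
  "leibniz_isomorphic s1 br1 s2 br2 \<longleftrightarrow> (\<exists>f. leibniz_algebra_hom s1 br1 s2 br2 f \<and> bij f)"


section \<open>The algebras \<open>L(\<alpha>)\<close>\<close>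

text \<open>
  The underlying vector space is \<^typ>\<open>complex^8\<close>.  The elements of the index type \<^typ>\<open>8\<close> are
  the residues \<open>0, \<dots>, 7\<close> modulo \<open>8\<close>, so \<open>e 0, \<dots>, e 7\<close> is the standard basis; \<open>e i\<close> is only
  ever used for \<open>i \<le> 7\<close>.  An algebra is represented by its bracket.
\<close>

definition e :: "nat \<Rightarrow> complex^8" where
  "e i = axis (of_nat i) 1"

definition L_basis ::
  "complex \<Rightarrow> complex \<Rightarrow> complex \<Rightarrow> complex \<Rightarrow> complex \<Rightarrow> complex \<Rightarrow> nat \<Rightarrow> nat \<Rightarrow> complex^8" where
  "L_basis b00 b01 b11 b12 b14 b i j =
    (if j = 0 \<and> 1 \<le> i \<and> i \<le> 6 then e (i + 1)
     else if i = 0 \<and> 2 \<le> j \<and> j \<le> 6 then - e (j + 1)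
     else if (i, j) = (0, 0) then b00 *s e 7
     else if (i, j) = (0, 1) then - e 2 + b01 *s e 7
     else if (i, j) = (1, 1) then b11 *s e 7
     else if (i, j) = (1, 2) then b12 *s e 7
     else if (i, j) = (2, 1) then - (b12 *s e 7)
     else if (i, j) = (1, 4) then b14 *s e 7
     else if (i, j) = (4, 1) then - (b14 *s e 7)
     else if (i, j) = (2, 3) then - (b14 *s e 7)
     else if (i, j) = (3, 2) then b14 *s e 7
     else if (i, j) = (1, 6) then - (b *s e 7)
     else if (i, j) = (6, 1) then b *s e 7
     else if (i, j) = (2, 5) then b *s e 7
     else if (i, j) = (5, 2) then - (b *s e 7)
     else if (i, j) = (3, 4) then - (b *s e 7)
     else if (i, j) = (4, 3) then b *s e 7
     else 0)"

definition L ::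
  "complex \<Rightarrow> complex \<Rightarrow> complex \<Rightarrow> complex \<Rightarrow> complex \<Rightarrow> complex \<Rightarrow>
   complex^8 \<Rightarrow> complex^8 \<Rightarrow> complex^8" where
  "L b00 b01 b11 b12 b14 b x y =
    (\<Sum>i<8. \<Sum>j<8. (x $ of_nat i * y $ of_nat j) *s L_basis b00 b01 b11 b12 b14 b i j)"

definition CE_mu7 :: "(complex^8 \<Rightarrow> complex^8 \<Rightarrow> complex^8) set" where
  "CE_mu7 = {L b00 b01 b11 b12 b14 b | b00 b01 b11 b12 b14 b. b \<in> {0, 1}}"

definition U9 :: "(complex^8 \<Rightarrow> complex^8 \<Rightarrow> complex^8) set" where
  "U9 = {L b00 b01 b11 b12 b14 b | b00 b01 b11 b12 b14 b.
          L b00 b01 b11 b12 b14 b \<in> CE_mu7 \<and> b = 0 \<and> b14 = 0 \<and> b12 \<noteq> 0 \<and> b11 \<noteq> 0}"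

abbreviation isomorphic8 ::
  "(complex^8 \<Rightarrow> complex^8 \<Rightarrow> complex^8) \<Rightarrow> (complex^8 \<Rightarrow> complex^8 \<Rightarrow> complex^8) \<Rightarrow> bool" where
  "isomorphic8 A B \<equiv> leibniz_isomorphic (*s) A (*s) B"

definition \<Delta> :: "complex \<Rightarrow> complex \<Rightarrow> complex \<Rightarrow> complex" where
  "\<Delta> b00 b01 b11 = b01 ^ 2 - 4 * b00 * b11"


section \<open>Consistency of the definitions\<close>

lemma exhaust_8:
  fixes k :: 8
  shows "k = 0 \<or> k = 1 \<or> k = 2 \<or> k = 3 \<or> k = 4 \<or> k = 5 \<or> k = 6 \<or> k = 7"
proof (induct k)
  case (of_int z)
  then have "z = 0 \<or> z = 1 \<or> z = 2 \<or> z = 3 \<or> z = 4 \<or> z = 5 \<or> z = 6 \<or> z = 7" by auto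
  then show ?case by auto
qed

lemma forall_8: "(\<forall>k::8. P k) \<longleftrightarrow> P 0 \<and> P 1 \<and> P 2 \<and> P 3 \<and> P 4 \<and> P 5 \<and> P 6 \<and> P 7"
  by (metis exhaust_8)

lemma sum_lessThan_8:
  "(\<Sum>i<8::nat. f i) = f 0 + f 1 + f 2 + f 3 + f 4 + f 5 + f 6 + (f 7 :: 'a::comm_monoid_add)"
  by (simp add: eval_nat_numeral lessThan_Suc ac_simps)

lemma L_e:
  assumes "i < 8" "j < 8"
  shows "L b00 b01 b11 b12 b14 b (e i) (e j) = L_basis b00 b01 b11 b12 b14 b i j"
proof -
  have "inj_on (of_nat :: nat \<Rightarrow> 8) {..<8}"
    by (rule inj_onI) (auto simp: less_Suc_eq eval_nat_numeral)
  then have "e k $ of_nat l = (if l = k then 1 else 0)" if "k < 8" "l < 8" for k l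
    using that by (auto simp: e_def axis_def inj_on_def)
  then have "L b00 b01 b11 b12 b14 b (e i) (e j) =
      (\<Sum>k<8. \<Sum>l<8. if l = j then if k = i then L_basis b00 b01 b11 b12 b14 b k l else 0 else 0)"
    unfolding L_def using assms by (intro sum.cong refl) auto
  also have "\<dots> = L_basis b00 b01 b11 b12 b14 b i j"
    using assms by (simp add: sum.delta)
  finally show ?thesis .
qed

lemma L_nth:
  "L b00 b01 b11 b12 b14 b x y $ 0 = 0"
  "L b00 b01 b11 b12 b14 b x y $ 1 = 0"
  "L b00 b01 b11 b12 b14 b x y $ 2 = x $ 1 * y $ 0 - x $ 0 * y $ 1"
  "L b00 b01 b11 b12 b14 b x y $ 3 = x $ 2 * y $ 0 - x $ 0 * y $ 2"
  "L b00 b01 b11 b12 b14 b x y $ 4 = x $ 3 * y $ 0 - x $ 0 * y $ 3"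
  "L b00 b01 b11 b12 b14 b x y $ 5 = x $ 4 * y $ 0 - x $ 0 * y $ 4"
  "L b00 b01 b11 b12 b14 b x y $ 6 = x $ 5 * y $ 0 - x $ 0 * y $ 5"
  "L b00 b01 b11 b12 b14 b x y $ 7 = x $ 6 * y $ 0 - x $ 0 * y $ 6
     + b00 * (x $ 0 * y $ 0) + b01 * (x $ 0 * y $ 1) + b11 * (x $ 1 * y $ 1)
     + b12 * (x $ 1 * y $ 2 - x $ 2 * y $ 1)
     + b14 * (x $ 1 * y $ 4 - x $ 4 * y $ 1 - x $ 2 * y $ 3 + x $ 3 * y $ 2)
     - b * (x $ 1 * y $ 6 - x $ 6 * y $ 1 - x $ 2 * y $ 5 + x $ 5 * y $ 2
            + x $ 3 * y $ 4 - x $ 4 * y $ 3)"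
  by (simp_all add: L_def L_basis_def sum_lessThan_8 e_def axis_def algebra_simps)

lemma leibniz_algebra_L: "leibniz_algebra (*s) (L b00 b01 b11 b12 b14 b)"
proof
  fix x y z :: "complex^8"
  show "L b00 b01 b11 b12 b14 b x (L b00 b01 b11 b12 b14 b y z) =
    L b00 b01 b11 b12 b14 b (L b00 b01 b11 b12 b14 b x y) z -
    L b00 b01 b11 b12 b14 b (L b00 b01 b11 b12 b14 b x z) y"
    unfolding vec_eq_iff forall_8 vector_minus_component L_nth by (simp add: algebra_simps)
qed (simp_all add: vec_eq_iff forall_8 L_nth algebra_simps)

lemma leibniz_algebra_CE_mu7: "A \<in> CE_mu7 \<Longrightarrow> leibniz_algebra (*s) A"
  by (auto simp: CE_mu7_def leibniz_algebra_L)

lemma L_inject: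
  assumes "L b00 b01 b11 b12 b14 b = L b00' b01' b11' b12' b14' b'"
  shows "b00 = b00' \<and> b01 = b01' \<and> b11 = b11' \<and> b12 = b12' \<and> b14 = b14' \<and> b = b'"
proof -
  have *: "L b00 b01 b11 b12 b14 b x y $ 7 = L b00' b01' b11' b12' b14' b' x y $ 7" for x y
    using assms by simp
  show ?thesis
    using *[of "e 0" "e 0"] *[of "e 0" "e 1"] *[of "e 1" "e 1"] *[of "e 1" "e 2"]
      *[of "e 1" "e 4"] *[of "e 2" "e 5"]
    by (simp add: L_nth e_def axis_def)
qed

lemma L_in_U9_iff:
  "L b00 b01 b11 b12 b14 b \<in> U9 \<longleftrightarrow> b = 0 \<and> b14 = 0 \<and> b12 \<noteq> 0 \<and> b11 \<noteq> 0"
proof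
  assume "b = 0 \<and> b14 = 0 \<and> b12 \<noteq> 0 \<and> b11 \<noteq> 0"
  moreover from this have "L b00 b01 b11 b12 b14 b \<in> CE_mu7"
    unfolding CE_mu7_def by blast
  ultimately show "L b00 b01 b11 b12 b14 b \<in> U9"
    unfolding U9_def by blast
qed (auto simp: U9_def dest: L_inject)

end

theory Submission
  imports Defs
begin

text \<open>
  An isomorphism \<open>f\<close> is determined by \<open>f (e 0)\<close> and \<open>f (e 1)\<close>, since these generate the algebra.
  Write \<open>p\<close>, \<open>r\<close> for the coordinates of \<open>f (e 0)\<close> at \<open>e 0\<close>, \<open>e 1\<close>, and \<open>q\<close> for that of \<open>f (e 1)\<close>
  at \<open>e 1\<close>.  As \<open>[e 2, e 1]\<close> is a multiple of \<open>e 7\<close>, the vector \<open>f (e 1)\<close> has no component at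
  \<open>e 0\<close>, and \<open>f (e 7) = p^6 q e 7\<close>.  Comparing the \<open>e 7\<close>-coordinates of the products of generators
  shows that the quadratic form \<open>b00 x^2 + b01 x y + b11 y^2\<close>, of discriminant \<open>\<Delta>\<close>, transforms by a
  triangular substitution up to the factor \<open>p^6 q\<close>, and that \<open>b12 p^5 = b12' q\<close>.  Hence
  \<open>\<Delta> p^10 = \<Delta>'\<close> and \<open>b12 / b11 = p (b12' / b11')\<close>.  Conversely these equations can be solved for
  \<open>p\<close>, \<open>q\<close>, \<open>r\<close> whenever the invariants agree.
\<close>

text \<open>The forced homomorphic extension of \<open>e 0\<close> to \<open>p e 0 + r e 1\<close>
  and \<open>e 1\<close> to \<open>q e 1\<close>, where \<open>b11\<close>, \<open>b12\<close>
  belong to the target algebra, whose other cocycle terms \<open>b14\<close>, \<open>b\<close>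
  vanish. The corrections at \<open>e 7\<close> come from \<open>[q e 1, r e 1]\<close> in the image
  of \<open>e 2\<close> and from \<open>[p q e 2, r e 1]\<close> in that of
  \<open>e 3\<close>.\<close>

definition change_of_generators ::
  "complex \<Rightarrow> complex \<Rightarrow> complex \<Rightarrow> complex \<Rightarrow> complex \<Rightarrow> complex^8 \<Rightarrow> complex^8" where
  "change_of_generators b11 b12 p q r x = (\<chi> i.
     if i = 0 then p * x $ 0
     else if i = 1 then r * x $ 0 + q * x $ 1
     else if i = 2 then p * q * x $ 2
     else if i = 3 then p ^ 2 * q * x $ 3
     else if i = 4 then p ^ 3 * q * x $ 4
     else if i = 5 then p ^ 4 * q * x $ 5
     else if i = 6 then p ^ 5 * q * x $ 6
     else p ^ 6 * q * x $ 7 + b11 * q * r * x $ 2 - b12 * p * q * r * x $ 3)"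

lemma change_of_generators_nth:
  "change_of_generators b11 b12 p q r x $ 0 = p * x $ 0"
  "change_of_generators b11 b12 p q r x $ 1 = r * x $ 0 + q * x $ 1"
  "change_of_generators b11 b12 p q r x $ 2 = p * q * x $ 2"
  "change_of_generators b11 b12 p q r x $ 3 = p ^ 2 * q * x $ 3"
  "change_of_generators b11 b12 p q r x $ 4 = p ^ 3 * q * x $ 4"
  "change_of_generators b11 b12 p q r x $ 5 = p ^ 4 * q * x $ 5"
  "change_of_generators b11 b12 p q r x $ 6 = p ^ 5 * q * x $ 6"
  "change_of_generators b11 b12 p q r x $ 7 =
     p ^ 6 * q * x $ 7 + b11 * q * r * x $ 2 - b12 * p * q * r * x $ 3"
  by (simp_all add: change_of_generators_def)

lemma bij_change_of_generators:
  assumes "p \<noteq> 0" "q \<noteq> 0"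
  shows "bij (change_of_generators b11 b12 p q r)"
proof (rule bijI)
  show "inj (change_of_generators b11 b12 p q r)"
    using assms by (auto intro!: injI simp: vec_eq_iff forall_8 change_of_generators_nth)
next
  define g :: "complex^8 \<Rightarrow> complex^8" where "g y = (\<chi> i.
     if i = 0 then y $ 0 / p
     else if i = 1 then (y $ 1 - r * (y $ 0 / p)) / q
     else if i = 2 then y $ 2 / (p * q)
     else if i = 3 then y $ 3 / (p ^ 2 * q)
     else if i = 4 then y $ 4 / (p ^ 3 * q)
     else if i = 5 then y $ 5 / (p ^ 4 * q)
     else if i = 6 then y $ 6 / (p ^ 5 * q)
     else (y $ 7 - b11 * q * r * (y $ 2 / (p * q)) + b12 * p * q * r * (y $ 3 / (p ^ 2 * q)))
            / (p ^ 6 * q))" for y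
  have "change_of_generators b11 b12 p q r (g y) = y" for y
    using assms unfolding vec_eq_iff forall_8 change_of_generators_nth by (simp add: g_def)
  then show "surj (change_of_generators b11 b12 p q r)"
    by (rule surjI)
qed

text \<open>The four equations are coordinate 7 of the homomorphism law on the pairs (0,0), (0,1),
  (1,1), (1,2) of basis vectors, up to nonzero factors; coordinates 0 to 6 agree for all
  \<open>p\<close>, \<open>q\<close>, \<open>r\<close>.\<close>

lemma isomorphic8_changeI:
  assumes nz: "p \<noteq> 0" "q \<noteq> 0"
    and eq00: "b00 * (p ^ 6 * q) = b00' * p ^ 2 + b01' * p * r + b11' * r ^ 2"
    and eq01: "b01 * p ^ 6 = b01' * p + 2 * b11' * r"
    and eq11: "b11 * p ^ 6 = b11' * q"
    and eq12: "b12 * p ^ 5 = b12' * q"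
  shows "isomorphic8 (L b00 b01 b11 b12 0 0) (L b00' b01' b11' b12' 0 0)"
proof -
  let ?f = "change_of_generators b11' b12' p q r"
  let ?A = "L b00 b01 b11 b12 0 0" and ?B = "L b00' b01' b11' b12' 0 0"
  interpret A: leibniz_algebra "(*s)" ?A by (rule leibniz_algebra_L)
  interpret B: leibniz_algebra "(*s)" ?B by (rule leibniz_algebra_L)
  have "leibniz_algebra_hom (*s) ?A (*s) ?B ?f"
  proof
    fix x y :: "complex^8"
    have "?f (?A x y) $ 7 = ?B (?f x) (?f y) $ 7"
    proof -
      have "?f (?A x y) $ 7 = p ^ 6 * q * (x $ 6 * y $ 0 - x $ 0 * y $ 6)
          + (b00 * (p ^ 6 * q)) * (x $ 0 * y $ 0) + (b01 * p ^ 6) * q * (x $ 0 * y $ 1)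
          + (b11 * p ^ 6) * q * (x $ 1 * y $ 1)
          + (b12 * p ^ 5) * p * q * (x $ 1 * y $ 2 - x $ 2 * y $ 1)
          + b11' * q * r * (x $ 1 * y $ 0 - x $ 0 * y $ 1)
          - b12' * p * q * r * (x $ 2 * y $ 0 - x $ 0 * y $ 2)"
        by (simp add: change_of_generators_nth L_nth) algebra
      also have "\<dots> = ?B (?f x) (?f y) $ 7"
        unfolding eq00 eq01 eq11 eq12 by (simp add: change_of_generators_nth L_nth) algebra
      finally show ?thesis .
    qed
    moreover have "?f (?A x y) $ i = ?B (?f x) (?f y) $ i" if "i \<in> {0, 1, 2, 3, 4, 5, 6}" for i
      using that
      by (auto simp: change_of_generators_nth L_nth algebra_simps eval_nat_numeral)
    ultimately show "?f (?A x y) = ?B (?f x) (?f y)"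
      unfolding vec_eq_iff forall_8 by simp
  qed (simp_all add: vec_eq_iff forall_8 change_of_generators_nth algebra_simps)
  then show ?thesis
    unfolding leibniz_isomorphic_def using bij_change_of_generators[OF nz] by blast
qed

text \<open>The given isomorphism need not be a \<open>change_of_generators\<close>: images of
  generators may have components at \<open>e 2\<close> to \<open>e 7\<close>, but these drop out of
  the coordinates compared.\<close>

lemma isomorphic8_changeD:
  assumes iso: "isomorphic8 (L b00 b01 b11 b12 0 0) (L b00' b01' b11' b12' 0 0)"
    and b12: "b12 \<noteq> 0"
  obtains p q r where "p \<noteq> 0" "q \<noteq> 0"
    "b00 * (p ^ 6 * q) = b00' * p ^ 2 + b01' * p * r + b11' * r ^ 2"
    "b01 * p ^ 6 = b01' * p + 2 * b11' * r"
    "b11 * p ^ 6 = b11' * q"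
    "b12 * p ^ 5 = b12' * q"
proof -
  let ?A = "L b00 b01 b11 b12 0 0" and ?B = "L b00' b01' b11' b12' 0 0"
  obtain f where f: "leibniz_algebra_hom (*s) ?A (*s) ?B f" and "bij f"
    using iso unfolding leibniz_isomorphic_def by blast
  interpret leibniz_algebra_hom "(*s)" ?A "(*s)" ?B f by (rule f)
  define p q r s where "p = f (e 0) $ 0" and "q = f (e 1) $ 1" and "r = f (e 0) $ 1"
    and "s = f (e 1) $ 0"
  note One_nat_def [simp del]
  have prod: "f (L_basis b00 b01 b11 b12 0 0 i j) = ?B (f (e i)) (f (e j))"
    if "i < 8" "j < 8" for i j
    using bracket[of "e i" "e j"] that by (simp add: L_e)
  have f2: "f (e 2) = ?B (f (e 1)) (f (e 0))"
    and f3: "f (e 3) = ?B (f (e 2)) (f (e 0))"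
    and f4: "f (e 4) = ?B (f (e 3)) (f (e 0))"
    and f5: "f (e 5) = ?B (f (e 4)) (f (e 0))"
    and f6: "f (e 6) = ?B (f (e 5)) (f (e 0))"
    and f7: "f (e 7) = ?B (f (e 6)) (f (e 0))"
    using prod[of 1 0] prod[of 2 0] prod[of 3 0] prod[of 4 0] prod[of 5 0] prod[of 6 0]
    by (simp_all add: L_basis_def)
  have f00: "b00 *s f (e 7) = ?B (f (e 0)) (f (e 0))"
    and f01: "- f (e 2) + b01 *s f (e 7) = ?B (f (e 0)) (f (e 1))"
    and f11: "b11 *s f (e 7) = ?B (f (e 1)) (f (e 1))"
    and f21: "- (b12 *s f (e 7)) = ?B (f (e 2)) (f (e 1))"
    using prod[of 0 0] prod[of 0 1] prod[of 1 1] prod[of 2 1]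
    by (simp_all add: L_basis_def add neg scale diff)
  \<comment> \<open>Right multiplication by \<open>f (e 0)\<close> shifts the leading index by one
    and multiplies the leading coefficient by \<open>p\<close>.\<close>
  have low2: "f (e 2) $ 0 = 0" "f (e 2) $ 1 = 0" "f (e 2) $ 2 = p * q - r * s"
    by (simp_all add: f2 L_nth p_def q_def r_def s_def algebra_simps)
  have low3: "f (e 3) $ 0 = 0" "f (e 3) $ 1 = 0" "f (e 3) $ 2 = 0"
      "f (e 3) $ 3 = (p * q - r * s) * p"
    by (simp_all only: f3 L_nth low2 p_def[symmetric]) simp_all
  have low4: "f (e 4) $ 0 = 0" "f (e 4) $ 1 = 0" "f (e 4) $ 2 = 0" "f (e 4) $ 3 = 0"
      "f (e 4) $ 4 = (p * q - r * s) * p * p"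
    by (simp_all only: f4 L_nth low3 p_def[symmetric]) simp_all
  have low5: "f (e 5) $ 0 = 0" "f (e 5) $ 1 = 0" "f (e 5) $ 2 = 0" "f (e 5) $ 3 = 0"
      "f (e 5) $ 4 = 0"
      "f (e 5) $ 5 = (p * q - r * s) * p * p * p"
    by (simp_all only: f5 L_nth low4 p_def[symmetric]) simp_all
  have low6: "f (e 6) $ 0 = 0" "f (e 6) $ 1 = 0" "f (e 6) $ 2 = 0" "f (e 6) $ 3 = 0"
      "f (e 6) $ 4 = 0" "f (e 6) $ 5 = 0"
      "f (e 6) $ 6 = (p * q - r * s) * p * p * p * p"
    by (simp_all only: f6 L_nth low5 p_def[symmetric]) simp_all
  have f7_nth: "f (e 7) $ 0 = 0" "f (e 7) $ 1 = 0" "f (e 7) $ 2 = 0" "f (e 7) $ 3 = 0"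
      "f (e 7) $ 4 = 0" "f (e 7) $ 5 = 0" "f (e 7) $ 6 = 0"
      "f (e 7) $ 7 = (p * q - r * s) * p * p * p * p * p"
    by (simp_all only: f7 L_nth low6 p_def[symmetric]) simp_all
  \<comment> \<open>Only coordinate 7 of \<open>f (e 7)\<close> can be nonzero, so injectivity makes
    each of its factors nonzero.\<close>
  have "f (e 7) \<noteq> 0"
  proof -
    have "e 7 \<noteq> 0" by (simp add: e_def axis_def vec_eq_iff forall_8)
    then show ?thesis using \<open>bij f\<close> zero by (metis bij_is_inj injD)
  qed
  then have nz: "p \<noteq> 0" "p * q - r * s \<noteq> 0"
    by (auto simp: vec_eq_iff forall_8 f7_nth)
  have "(p * q - r * s) * s = 0"
    using arg_cong[OF f21, of "\<lambda>v. v $ 3"] by (simp add: f7_nth L_nth low2 s_def)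
  with nz have s0: "s = 0" by simp
  with nz have q0: "q \<noteq> 0" by simp
  have f7_7: "f (e 7) $ 7 = p ^ 6 * q" unfolding f7_nth s0 by algebra
  have "b12 * (p ^ 6 * q) = b12' * (p * q) * q"
    using arg_cong[OF f21, of "\<lambda>v. v $ 7"] s0
    by (simp add: f7_7 L_nth low2 flip: s_def p_def q_def r_def)
  then have "(b12 * p ^ 5) * (p * q) = (b12' * q) * (p * q)" by algebra
  then have eq12: "b12 * p ^ 5 = b12' * q" using nz q0 by simp
  have "(b11 * p ^ 6) * q = (b11' * q) * q"
    using arg_cong[OF f11, of "\<lambda>v. v $ 7"] s0
    by (simp add: f7_7 L_nth flip: s_def p_def q_def r_def)
  then have eq11: "b11 * p ^ 6 = b11' * q" using q0 by simp
  have eq00: "b00 * (p ^ 6 * q) = b00' * p ^ 2 + b01' * p * r + b11' * r ^ 2"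
    using arg_cong[OF f00, of "\<lambda>v. v $ 7"]
    by (simp add: f7_7 L_nth power2_eq_square flip: s_def p_def q_def r_def)
  \<comment> \<open>Symmetrizing the product of the generators cancels the unknown coordinate 7 of
    \<open>f (e 2)\<close>.\<close>
  have "(- f (e 2) + b01 *s f (e 7)) $ 7 + f (e 2) $ 7
      = ?B (f (e 0)) (f (e 1)) $ 7 + ?B (f (e 1)) (f (e 0)) $ 7"
    using f01 f2 by metis
  then have "(b01 * p ^ 6) * q = (b01' * p + 2 * b11' * r) * q"
    using s0 by (simp add: f7_7 L_nth algebra_simps flip: s_def p_def q_def r_def)
  then have eq01: "b01 * p ^ 6 = b01' * p + 2 * b11' * r" using q0 by simp
  show thesis using that[OF nz(1) q0 eq00 eq01 eq11 eq12] .
qed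

lemma U9_isomorphic8_iff:
  assumes nz: "b11 \<noteq> 0" "b12 \<noteq> 0" "b11' \<noteq> 0" "b12' \<noteq> 0"
  shows "isomorphic8 (L b00 b01 b11 b12 0 0) (L b00' b01' b11' b12' 0 0) \<longleftrightarrow>
    (b12 / b11) ^ 10 * \<Delta> b00 b01 b11 = (b12' / b11') ^ 10 * \<Delta> b00' b01' b11'"
    (is "?iso \<longleftrightarrow> ?inv")
proof
  assume ?iso
  then obtain p q r where pq: "p \<noteq> 0" "q \<noteq> 0"
    and eq00: "b00 * (p ^ 6 * q) = b00' * p ^ 2 + b01' * p * r + b11' * r ^ 2"
    and eq01: "b01 * p ^ 6 = b01' * p + 2 * b11' * r"
    and eq11: "b11 * p ^ 6 = b11' * q"
    and eq12: "b12 * p ^ 5 = b12' * q"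
    using nz(2) by (rule isomorphic8_changeD)
  \<comment> \<open>With the factor \<open>p ^ 12\<close>, replacing \<open>b11 * p ^ 6\<close> by
    \<open>b11' * q\<close> supplies the \<open>q\<close> that \<open>eq00\<close> requires.\<close>
  have "\<Delta> b00 b01 b11 * p ^ 12 = (b01 * p ^ 6) ^ 2 - 4 * (b00 * p ^ 6) * (b11 * p ^ 6)"
    by (simp add: \<Delta>_def) algebra
  also have "\<dots> = (b01 * p ^ 6) ^ 2 - 4 * (b00 * (p ^ 6 * q)) * b11'"
    unfolding eq11 by algebra
  also have "\<dots> = \<Delta> b00' b01' b11' * p ^ 2"
    unfolding eq01 eq00 by (simp add: \<Delta>_def) algebra
  finally have "(\<Delta> b00 b01 b11 * p ^ 10) * p ^ 2 = \<Delta> b00' b01' b11' * p ^ 2"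
    by algebra
  then have disc: "\<Delta> b00' b01' b11' = \<Delta> b00 b01 b11 * p ^ 10" using pq by simp
  have "(b12 * b11') * (p ^ 5 * q) = (p * b12' * b11) * (p ^ 5 * q)"
    using eq11 eq12 by algebra
  then have ratio: "b12 / b11 = p * (b12' / b11')"
    using nz pq by (simp add: field_simps)
  show ?inv unfolding ratio disc power_mult_distrib by (simp only: ac_simps)
next
  assume inv: ?inv
  \<comment> \<open>The ratio of \<open>b12\<close> to \<open>b11\<close> forces \<open>p\<close>;
    then \<open>eq12\<close> gives \<open>q\<close> and \<open>eq01\<close> gives \<open>r\<close>.
    \<open>eq11\<close> follows from the choice of \<open>p\<close>, and only \<open>eq00\<close>
    depends on the invariant.\<close>
  define p where "p = (b12 / b11) / (b12' / b11')"
  define q where "q = b12 * p ^ 5 / b12'"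
  define r where "r = (b01 * p ^ 6 - b01' * p) / (2 * b11')"
  have pq: "p \<noteq> 0" "q \<noteq> 0" using nz by (simp_all add: p_def q_def)
  have eq12: "b12 * p ^ 5 = b12' * q" using nz by (simp add: q_def)
  have eq01: "b01 * p ^ 6 = b01' * p + 2 * b11' * r" using nz by (simp add: r_def)
  have ratio: "b12 / b11 = p * (b12' / b11')" using nz by (simp add: p_def)
  then have "p * b11 * b12' = b12 * b11'" using nz by (simp add: field_simps)
  then have "b12' * (b11 * p ^ 6) = b12' * (b11' * q)" using eq12 by algebra
  then have eq11: "b11 * p ^ 6 = b11' * q" using nz by simp
  have "(b12' / b11') ^ 10 * (\<Delta> b00 b01 b11 * p ^ 10) = (b12' / b11') ^ 10 * \<Delta> b00' b01' b11'"
    using inv unfolding ratio power_mult_distrib by (simp only: ac_simps)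
  then have disc: "\<Delta> b00' b01' b11' = \<Delta> b00 b01 b11 * p ^ 10"
    using nz by simp
  have "4 * b11' * (b00 * (p ^ 6 * q)) = 4 * (b00 * p ^ 6) * (b11 * p ^ 6)"
    unfolding eq11 by algebra
  also have "\<dots> = (b01 * p ^ 6) ^ 2 - (\<Delta> b00 b01 b11 * p ^ 10) * p ^ 2"
    by (simp add: \<Delta>_def) algebra
  also have "\<dots> = 4 * b11' * (b00' * p ^ 2 + b01' * p * r + b11' * r ^ 2)"
    unfolding eq01 disc[symmetric] by (simp add: \<Delta>_def) algebra
  finally have eq00: "b00 * (p ^ 6 * q) = b00' * p ^ 2 + b01' * p * r + b11' * r ^ 2"
    using nz by simp
  show ?iso by (rule isomorphic8_changeI[OF pq eq00 eq01 eq11 eq12])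
qed

theorem proposition3p14:
  shows "(\<forall>b00 b01 b11 b12 b14 b b00' b01' b11' b12' b14' b'.
      L b00 b01 b11 b12 b14 b \<in> U9 \<longrightarrow> L b00' b01' b11' b12' b14' b' \<in> U9 \<longrightarrow>
      (isomorphic8 (L b00 b01 b11 b12 b14 b) (L b00' b01' b11' b12' b14' b') \<longleftrightarrow>
       (b12 / b11) ^ 10 * \<Delta> b00 b01 b11 = (b12' / b11') ^ 10 * \<Delta> b00' b01' b11'))
    \<and> (\<forall>c. \<exists>b00 b01 b11 b12 b14 b.
      L b00 b01 b11 b12 b14 b \<in> U9 \<and> (b12 / b11) ^ 10 * \<Delta> b00 b01 b11 = c)
    \<and> (\<forall>A\<in>U9. \<exists>c. isomorphic8 A (L c 0 1 1 0 0))"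
proof (intro conjI allI ballI impI)
  fix b00 b01 b11 b12 b14 b b00' b01' b11' b12' b14' b'
  assume "L b00 b01 b11 b12 b14 b \<in> U9" "L b00' b01' b11' b12' b14' b' \<in> U9"
  then show "isomorphic8 (L b00 b01 b11 b12 b14 b) (L b00' b01' b11' b12' b14' b') \<longleftrightarrow>
       (b12 / b11) ^ 10 * \<Delta> b00 b01 b11 = (b12' / b11') ^ 10 * \<Delta> b00' b01' b11'"
    by (simp add: L_in_U9_iff U9_isomorphic8_iff)
next
  fix c
  \<comment> \<open>At \<open>b01 = 0\<close>, \<open>b11 = b12 = 1\<close> the invariant is
    \<open>-4 * b00\<close>.\<close>
  have "L (- c / 4) 0 1 1 0 0 \<in> U9 \<and> (1 / 1) ^ 10 * \<Delta> (- c / 4) 0 1 = c"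
    by (simp add: L_in_U9_iff \<Delta>_def)
  then show "\<exists>b00 b01 b11 b12 b14 b.
      L b00 b01 b11 b12 b14 b \<in> U9 \<and> (b12 / b11) ^ 10 * \<Delta> b00 b01 b11 = c"
    by blast
next
  fix A assume "A \<in> U9"
  then obtain b00 b01 b11 b12 where A: "A = L b00 b01 b11 b12 0 0" and nz: "b11 \<noteq> 0" "b12 \<noteq> 0"
    by (auto simp: U9_def)
  \<comment> \<open>The first parameter is the invariant of \<open>A\<close> divided by -4, so that
    both invariants agree.\<close>
  have "isomorphic8 A (L (- ((b12 / b11) ^ 10 * \<Delta> b00 b01 b11) / 4) 0 1 1 0 0)"
    unfolding A using nz by (subst U9_isomorphic8_iff) (simp_all add: \<Delta>_def)
  then show "\<exists>c. isomorphic8 A (L c 0 1 1 0 0)" by blast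
qed

end
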